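(* Let $R>0$, $A<\infty$ and $\chi>1$ be given. Then there exist $\rho>0$ and $a>0$ with the following property: if $\mathcal D\subset\mathbb C$ is a simply connected domain containing the origin, and if $\phi:\mathcal D\to B_R$ is a proper holomorphic mapping into the ball $B_R$ of radius $R$ about the origin in $\mathbb C^n$, with $\phi(0)=0$ and $\mathrm{Area}(\phi(\mathcal D))\le A$, then for some $r>0$ the component $D_0$ of $\phi^{-1}(B_{\rho R})$ containing the origin satisfies $$\{|\zeta|<ar\}\subset D_0\subset\{|\zeta|<r\}\subset\{|\zeta|<\chi r\}\subset\mathcal D.$$
   Context: $B_R=B(0,R)$ denotes the open Euclidean ball in $\mathbb C^n$ ($n\ge1$) of radius $R$ centered at $0$. $\mathrm{Area}(\phi(\mathcal D))$ is the area counted with multiplicity, i.e. $\int_{\mathcal D}|\phi'|^2$. *)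

theory Defs
  imports "HOL-Complex_Analysis.Complex_Analysis"
begin

text \<open>
  The space \<open>\<complex>\<^sup>n\<close> is rendered as \<^typ>\<open>complex ^ 'n\<close>, whose library norm is the Euclidean
  (Hermitian) one. Since \<^const>\<open>holomorphic_on\<close> and \<^const>\<open>deriv\<close> only concern functions
  with values in a field, holomorphy and the complex derivative of a map into \<open>\<complex>\<^sup>n\<close> are
  taken componentwise.
\<close>

definition holomorphic_map_on :: "(complex \<Rightarrow> complex ^ 'n) \<Rightarrow> complex set \<Rightarrow> bool"
  where "holomorphic_map_on \<phi> D \<longleftrightarrow> (\<forall>i. (\<lambda>z. \<phi> z $ i) holomorphic_on D)"

definition map_deriv :: "(complex \<Rightarrow> complex ^ 'n) \<Rightarrow> complex \<Rightarrow> complex ^ 'n"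
  where "map_deriv \<phi> z = (\<chi> i. deriv (\<lambda>w. \<phi> w $ i) z)"

text \<open>
  Area of the image counted with multiplicity. The nonnegative integral is used so that an
  infinite area is \<open>\<infinity>\<close>.
\<close>

definition image_area :: "(complex \<Rightarrow> complex ^ 'n) \<Rightarrow> complex set \<Rightarrow> ennreal"
  where "image_area \<phi> D = (\<integral>\<^sup>+ z\<in>D. ennreal ((norm (map_deriv \<phi> z))\<^sup>2) \<partial>lborel)"

text \<open>
  A proper holomorphic map from \<open>D\<close> into \<open>E\<close> is one that is proper in the sense of the
  library's \<^const>\<open>proper_map\<close> (closed with compact fibres) for the subspace topologies. The
  lemma below is the usual formulation through preimages of compact sets.
\<close>

definition proper_holomorphic_map ::
    "complex set \<Rightarrow> (complex ^ 'n) set \<Rightarrow> (complex \<Rightarrow> complex ^ 'n) \<Rightarrow> bool"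
  where "proper_holomorphic_map D E \<phi> \<longleftrightarrow>
    holomorphic_map_on \<phi> D \<and> proper_map (top_of_set D) (top_of_set E) \<phi>"

lemma proper_holomorphic_map_iff_compact:
  "proper_holomorphic_map D E \<phi> \<longleftrightarrow>
    holomorphic_map_on \<phi> D \<and> \<phi> ` D \<subseteq> E \<and>
    (\<forall>K. compact K \<and> K \<subseteq> E \<longrightarrow> compact {z \<in> D. \<phi> z \<in> K})"
proof -
  have "k_space (top_of_set E)"
    by (intro metrizable_imp_k_space metrizable_space_subtopology metrizable_space_euclidean)
  moreover have "kc_space (top_of_set E)" "kc_space (top_of_set D)"
    by (simp_all add: Hausdorff_imp_kc_space Hausdorff_space_subtopology)
  ultimately show ?thesis
    unfolding proper_holomorphic_map_def
    by (subst proper_eq_compact_map) (auto simp: compactin_subtopology)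
qed

end

theory Submission
  imports Defs
begin

text \<open>
  Let \<open>d\<close> be the distance from \<open>0\<close> to the complement of \<open>D\<close>, finite by Liouville's theorem, and
  let \<open>p \<notin> D\<close> with \<open>\<bar>p\<bar> = d\<close>. The radius is \<open>r = d / c\<close>, so that the disc of radius \<open>c r\<close> lies
  in \<open>D\<close>. The Schwarz lemma, applied to the components of \<open>\<phi>\<close> on the disc of radius \<open>d\<close>, gives
  \<open>\<bar>\<phi>(z)\<bar> \<le> n R \<bar>z\<bar> / d\<close>, hence the inner disc with \<open>a = \<rho> c / n\<close>. What remains is that the
  component \<open>D0\<close> cannot reach the circle of radius \<open>r\<close> when \<open>\<rho>\<close> is small.

  Suppose that it does. Being connected, it meets every circle about \<open>0\<close> of radius at most \<open>d / c\<close>,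
  so each such circle carries a point where \<open>\<bar>\<phi>\<bar> < \<rho> R\<close>. A normal families argument
  (\<open>small_on_circles_imp_small\<close>) then makes \<open>\<phi>\<close> small on the whole disc of radius
  \<open>(1 - \<delta>) d\<close>, for \<open>\<delta>\<close> as small as desired: \<open>\<bar>\<phi>\<bar> \<le> R / 2\<close> there.

  This contradicts the area bound by a length-area estimate at the boundary point \<open>p\<close>
  (\<open>image_area_ge_log\<close>). Let \<open>\<delta> d \<le> t \<le> d / 2\<close> and consider the boundary of the square with centre
  \<open>p\<close> and half side \<open>t\<close>. It contains a point of the disc of radius \<open>(1 - \<delta>) d\<close>, and, since \<open>D\<close> is
  simply connected and \<open>p \<notin> D\<close>, it also leaves \<open>D\<close>. As \<open>\<phi>\<close> is proper, \<open>\<bar>\<phi>\<bar>\<close> extended by \<open>R\<close> is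
  continuous on the plane, so it varies by at least \<open>R / 2\<close> on the square and by \<open>R / 8\<close> on one of
  its sides. By Cauchy--Schwarz the integral of \<open>\<bar>\<phi>'\<bar>\<^sup>2\<close> over the line through that side is at least
  a constant multiple of \<open>R\<^sup>2 / t\<close>. Integrating over \<open>t\<close> bounds the area below by a multiple of
  \<open>R\<^sup>2 ln (1 / (2 \<delta>))\<close>, which is unbounded as \<open>\<delta>\<close> tends to \<open>0\<close>. Squares rather than circles are
  used because for them Fubini's theorem in Cartesian coordinates suffices.
\<close>

section \<open>Iterated integrals over the complex plane\<close>

lemma lborel_complex_eq_distr:
  "lborel = distr (lborel \<Otimes>\<^sub>M lborel) borel (\<lambda>(x, y). Complex x y)"
proof (rule lborel_eqI)
  have meas: "(\<lambda>(x, y). Complex x y) \<in> lborel \<Otimes>\<^sub>M lborel \<rightarrow>\<^sub>M borel"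
    unfolding Complex_eq by measurable
  fix l u :: complex
  assume le: "\<And>b. b \<in> Basis \<Longrightarrow> l \<bullet> b \<le> u \<bullet> b"
  have "Re l \<le> Re u" "Im l \<le> Im u"
    using le[of 1] le[of \<i>] by (auto simp: Basis_complex_def inner_complex_def)
  moreover have "(\<lambda>(x, y). Complex x y) -` box l u \<inter> space (lborel \<Otimes>\<^sub>M lborel)
      = {Re l<..<Re u} \<times> {Im l<..<Im u}"
    by (auto simp: in_box_complex_iff space_pair_measure)
  ultimately show "emeasure (distr (lborel \<Otimes>\<^sub>M lborel) borel (\<lambda>(x, y). Complex x y)) (box l u)
      = (\<Prod>b\<in>Basis. (u - l) \<bullet> b)"
    using meas
    by (simp add: emeasure_distr lborel.emeasure_pair_measure_Times Basis_complex_def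
        inner_complex_def flip: ennreal_mult)
qed simp

lemma nn_integral_complex_iterated:
  assumes [measurable]: "f \<in> borel_measurable borel"
  shows "(\<integral>\<^sup>+z. f z \<partial>lborel) = (\<integral>\<^sup>+x. \<integral>\<^sup>+y. f (Complex x y) \<partial>lborel \<partial>lborel)"
    and "(\<integral>\<^sup>+z. f z \<partial>lborel) = (\<integral>\<^sup>+y. \<integral>\<^sup>+x. f (Complex x y) \<partial>lborel \<partial>lborel)"
proof -
  have meas [measurable]: "(\<lambda>(x, y). Complex x y) \<in> lborel \<Otimes>\<^sub>M lborel \<rightarrow>\<^sub>M borel"
    unfolding Complex_eq by measurable
  have f: "(\<lambda>p. f (case p of (x, y) \<Rightarrow> Complex x y)) \<in> borel_measurable (lborel \<Otimes>\<^sub>M lborel)"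
    using measurable_compose[OF meas assms] .
  have eq: "(\<integral>\<^sup>+z. f z \<partial>lborel) = (\<integral>\<^sup>+p. f (case p of (x, y) \<Rightarrow> Complex x y) \<partial>(lborel \<Otimes>\<^sub>M lborel))"
    by (subst lborel_complex_eq_distr) (simp add: nn_integral_distr)
  show "(\<integral>\<^sup>+z. f z \<partial>lborel) = (\<integral>\<^sup>+x. \<integral>\<^sup>+y. f (Complex x y) \<partial>lborel \<partial>lborel)"
    using lborel.nn_integral_fst[OF f] eq by simp
  show "(\<integral>\<^sup>+z. f z \<partial>lborel) = (\<integral>\<^sup>+y. \<integral>\<^sup>+x. f (Complex x y) \<partial>lborel \<partial>lborel)"
    using lborel_pair.nn_integral_snd[OF f] eq
    by (simp add: case_prod_beta')
qed

text \<open>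
  A lower bound, for each \<open>t\<close>, on the integral of \<open>q\<close> along one of the four lines that bound the
  square of half side \<open>t\<close> about \<open>p\<close> integrates to a lower bound on the integral over the plane. Each
  of the four families of lines sweeps out the plane at most once, whence the factor \<open>4\<close>.
\<close>

lemma four_sides_integral_le:
  fixes q :: "complex \<Rightarrow> ennreal"
  assumes [measurable]: "q \<in> borel_measurable borel" and ab: "0 < a" "a \<le> b" and K: "0 \<le> K"
    and side: "\<And>t. \<lbrakk>a \<le> t; t \<le> b\<rbrakk> \<Longrightarrow> \<exists>\<sigma>\<in>{1, -1}.
      ennreal (K / t) \<le> (\<integral>\<^sup>+s. q (Complex (Re p + \<sigma> * t) s) \<partial>lborel) \<or>
      ennreal (K / t) \<le> (\<integral>\<^sup>+s. q (Complex s (Im p + \<sigma> * t)) \<partial>lborel)"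
  shows "ennreal (K * ln (b / a)) \<le> 4 * (\<integral>\<^sup>+z. q z \<partial>lborel)"
proof -
  have [measurable]: "(\<lambda>(x, y). Complex x y) \<in> borel \<Otimes>\<^sub>M borel \<rightarrow>\<^sub>M borel"
    unfolding Complex_eq by measurable
  have q2 [measurable]: "(\<lambda>(x, y). q (Complex x y)) \<in> borel_measurable (borel \<Otimes>\<^sub>M borel)"
    "(\<lambda>(y, x). q (Complex x y)) \<in> borel_measurable (borel \<Otimes>\<^sub>M borel)"
    unfolding Complex_eq by measurable
  \<comment> \<open>The integrals along the vertical and the horizontal lines.\<close>
  define V where "V x = (\<integral>\<^sup>+s. q (Complex x s) \<partial>lborel)" for x
  define H where "H y = (\<integral>\<^sup>+s. q (Complex s y) \<partial>lborel)" for y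
  have [measurable]: "V \<in> borel_measurable borel" "H \<in> borel_measurable borel"
    unfolding V_def H_def by (auto intro!: lborel.borel_measurable_nn_integral)
  let ?I = "\<integral>\<^sup>+z. q z \<partial>lborel"
  have VH: "(\<integral>\<^sup>+t. V (Re p + \<sigma> * t) \<partial>lborel) = ?I" "(\<integral>\<^sup>+t. H (Im p + \<sigma> * t) \<partial>lborel) = ?I"
    if "\<sigma> \<in> {1, -1}" for \<sigma>
    using that nn_integral_complex_iterated[of q] nn_integral_real_affine[of V \<sigma> "Re p"]
      nn_integral_real_affine[of H \<sigma> "Im p"]
    by (auto simp: V_def[symmetric] H_def[symmetric])
  have "((\<lambda>t. K / t) has_integral K * ln b - K * ln a) {a..b}"
  proof (rule fundamental_theorem_of_calculus)
    show "((\<lambda>t. K * ln t) has_vector_derivative K / t) (at t within {a..b})" if "t \<in> {a..b}" for t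
      using that ab
        by (auto intro!: derivative_eq_intros
            simp flip: has_real_derivative_iff_has_vector_derivative)
  qed (use ab in auto)
  then have "((\<lambda>t. K / t) has_integral K * ln (b / a)) {a..b}"
    using ab by (simp add: ln_div right_diff_distrib)
  then have "ennreal (K * ln (b / a)) = (\<integral>\<^sup>+t. ennreal (K / t) * indicator {a..b} t \<partial>lborel)"
    using ab K by (intro nn_integral_has_integral_lebesgue'[symmetric]) auto
  also have "\<dots> \<le> (\<integral>\<^sup>+t. (V (Re p + 1 * t) + V (Re p + (-1) * t)) +
      (H (Im p + 1 * t) + H (Im p + (-1) * t)) \<partial>lborel)"
  proof (rule nn_integral_mono)
    fix t
    show "ennreal (K / t) * indicator {a..b} t \<le> (V (Re p + 1 * t) + V (Re p + (-1) * t)) +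
      (H (Im p + 1 * t) + H (Im p + (-1) * t))"
    proof (cases "t \<in> {a..b}")
      case True
      have sum4: "v1 \<le> v1 + v2 + (v3 + v4)" "v2 \<le> v1 + v2 + (v3 + v4)"
        "v3 \<le> v1 + v2 + (v3 + v4)" "v4 \<le> v1 + v2 + (v3 + v4)" for v1 v2 v3 v4 :: ennreal
        by (metis add.commute add.assoc le_iff_add)+
      have "ennreal (K / t) \<le> V (Re p + 1 * t) \<or> ennreal (K / t) \<le> V (Re p + (-1) * t) \<or>
          ennreal (K / t) \<le> H (Im p + 1 * t) \<or> ennreal (K / t) \<le> H (Im p + (-1) * t)"
        using side[of t] True by (auto simp: V_def[symmetric] H_def[symmetric])
      then have "ennreal (K / t) \<le> (V (Re p + 1 * t) + V (Re p + (-1) * t)) +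
          (H (Im p + 1 * t) + H (Im p + (-1) * t))"
        by (elim disjE) (rule order_trans, assumption, rule sum4)+
      then show ?thesis using True by simp
    qed auto
  qed
  also have "\<dots> = (?I + ?I) + (?I + ?I)"
    using VH[of 1] VH[of "-1"] by (simp add: nn_integral_add)
  also have "\<dots> = 4 * ?I" by (simp add: mult_2[symmetric] mult.assoc[symmetric])
  finally show ?thesis .
qed

section \<open>Smallness from smallness on circles\<close>

text \<open>
  If the conclusion failed for every \<open>\<rho>\<close>, a limit of counterexamples would vanish somewhere on each
  circle of radius at most \<open>s\<close>, hence identically, by the identity theorem at \<open>0\<close>.
\<close>

lemma small_on_circles_imp_small:
  fixes s \<delta> \<epsilon> :: real
  assumes s: "0 < s" "s < 1" and \<delta>: "0 < \<delta>" and \<epsilon>: "0 < \<epsilon>"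
  obtains \<rho> where "0 < \<rho>"
    "\<And>f z. \<lbrakk>f holomorphic_on ball 0 1; \<And>w. norm w < 1 \<Longrightarrow> norm (f w) \<le> 1;
       \<And>t. \<lbrakk>0 \<le> t; t \<le> s\<rbrakk> \<Longrightarrow> \<exists>w. norm w = t \<and> norm (f w) < \<rho>; norm z \<le> 1 - \<delta>\<rbrakk>
     \<Longrightarrow> norm (f z) \<le> \<epsilon>"
proof (rule ccontr)
  note obt = that
  define P where "P \<rho> f z \<longleftrightarrow> f holomorphic_on ball 0 1 \<and> (\<forall>w. norm w < 1 \<longrightarrow> norm (f w) \<le> 1) \<and>
    (\<forall>t. 0 \<le> t \<and> t \<le> s \<longrightarrow> (\<exists>w. norm w = t \<and> norm (f w) < \<rho>)) \<and> norm z \<le> 1 - \<delta> \<and>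
    norm (f z) > \<epsilon>" for \<rho> :: real and f :: "complex \<Rightarrow> complex" and z
  assume contra: "\<not> thesis"
  have "\<exists>f z. P (inverse (real (Suc n))) f z" for n
  proof (rule ccontr)
    assume "\<not> ?thesis"
    then show False
      using contra obt[of "inverse (real (Suc n))"] unfolding P_def
      by (metis not_le inverse_positive_iff_positive of_nat_0_less_iff zero_less_Suc)
  qed
  then obtain F Z where FZ: "\<And>n. P (inverse (real (Suc n))) (F n) (Z n)" by metis
  have F_hol: "F n holomorphic_on ball 0 1" and F_le: "norm w < 1 \<Longrightarrow> norm (F n w) \<le> 1"
    and F_circ: "0 \<le> t \<Longrightarrow> t \<le> s \<Longrightarrow> \<exists>w. norm w = t \<and> norm (F n w) < inverse (real (Suc n))"
    and Z: "norm (Z n) \<le> 1 - \<delta>" "norm (F n (Z n)) > \<epsilon>" for n w t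
    using FZ[of n] by (auto simp: P_def)
  obtain g r where g: "g holomorphic_on ball 0 1" and r: "strict_mono r"
    and lim: "\<And>K. compact K \<Longrightarrow> K \<subseteq> ball 0 1 \<Longrightarrow> uniform_limit K (F \<circ> r) g sequentially"
  proof (rule Montel[of "ball 0 1" "range F" F])
    show "\<exists>B. \<forall>h\<in>range F. \<forall>z\<in>K. norm (h z) \<le> B" if "K \<subseteq> ball 0 1" for K
      using that F_le by (intro exI[of _ 1]) (auto simp: subset_iff)
  qed (use F_hol in auto)
  \<comment> \<open>The limit inherits a zero on each of the circles.\<close>
  have zero: "\<exists>z. norm z = t \<and> g z = 0" if t: "0 \<le> t" "t \<le> s" for t
  proof -
    have sub: "sphere 0 t \<subseteq> ball (0::complex) 1" using t s by auto
    have ne: "sphere (0::complex) t \<noteq> {}" using t by simp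
    have "continuous_on (sphere 0 t) (\<lambda>z. norm (g z))"
      using holomorphic_on_imp_continuous_on[OF holomorphic_on_subset[OF g sub]]
      by (intro continuous_intros)
    from continuous_attains_inf[OF compact_sphere ne this]
    obtain z where z: "norm z = t" and inf: "\<And>w. norm w = t \<Longrightarrow> norm (g z) \<le> norm (g w)"
      by auto
    have "norm (g z) \<le> e" if e: "e > 0" for e
    proof -
      have ev1: "\<forall>\<^sub>F n in sequentially. \<forall>w\<in>sphere 0 t. dist ((F \<circ> r) n w) (g w) < e / 2"
        using lim[OF compact_sphere sub, unfolded uniform_limit_iff, rule_format, of "e / 2"] e by simp
      have ev2: "\<forall>\<^sub>F n in sequentially. inverse (real (Suc n)) < e / 2"
        using LIMSEQ_inverse_real_of_nat e by (intro order_tendstoD) auto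
      obtain n where n: "\<forall>w\<in>sphere 0 t. dist ((F \<circ> r) n w) (g w) < e / 2"
        "inverse (real (Suc n)) < e / 2"
        using eventually_happens'[OF _ eventually_conj[OF ev1 ev2]] by auto
      obtain w where w: "norm w = t" "norm (F (r n) w) < inverse (real (Suc (r n)))"
        using F_circ t by blast
      have "inverse (real (Suc (r n))) \<le> inverse (real (Suc n))"
        using seq_suble[OF r, of n] by (intro le_imp_inverse_le) auto
      moreover have "norm (g w) \<le> norm (F (r n) w) + dist (F (r n) w) (g w)"
        by (simp add: dist_norm norm_minus_commute norm_triangle_sub)
      moreover have "dist (F (r n) w) (g w) < e / 2" using n(1) w(1) by simp
      ultimately show ?thesis using inf[OF w(1)] n(2) w(2) by linarith
    qed
    then have "norm (g z) \<le> 0" by (meson dense not_less order.strict_trans2)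
    with z show ?thesis by auto
  qed
  have lim0: "0 islimpt {z \<in> ball 0 1. g z = 0}"
  proof (unfold islimpt_approachable, intro allI impI)
    fix e :: real assume "e > 0"
    then obtain z where "norm z = min s (e / 2)" "g z = 0" using zero[of "min s (e / 2)"] s by auto
    then show "\<exists>x'\<in>{z \<in> ball 0 1. g z = 0}. x' \<noteq> 0 \<and> dist x' 0 < e"
      using s \<open>e > 0\<close> by (intro bexI[of _ z]) (auto simp: min_def split: if_splits)
  qed
  have g0: "g w = 0" if "norm w < 1" for w
  proof (rule analytic_continuation[OF g open_ball connected_ball])
    show "{z \<in> ball 0 1. g z = 0} \<subseteq> ball 0 1" by blast
    show "g z = 0" if "z \<in> {z \<in> ball 0 1. g z = 0}" for z using that by blast
    show "0 islimpt {z \<in> ball 0 1. g z = 0}" by (rule lim0)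
    show "0 \<in> ball (0 :: complex) 1" by simp
    show "w \<in> ball 0 1" using that by simp
  qed
  have "cball 0 (1 - \<delta>) \<subseteq> ball (0::complex) 1" using \<delta> by auto
  from lim[OF compact_cball this] have "\<forall>\<^sub>F n in sequentially.
      \<forall>w\<in>cball 0 (1 - \<delta>). dist ((F \<circ> r) n w) (g w) < \<epsilon>"
    using \<epsilon> unfolding uniform_limit_iff by blast
  then obtain n where n: "\<forall>w\<in>cball 0 (1 - \<delta>). dist ((F \<circ> r) n w) (g w) < \<epsilon>"
    using eventually_happens'[OF sequentially_bot] by blast
  show False
    using n[THEN bspec, of "Z (r n)"] Z[of "r n"] g0[of "Z (r n)"] \<delta> by auto
qed

section \<open>The length-area inequality on a line\<close>

lemma norm_vec_lambda_mult: "norm (\<chi> i. w * v $ i) = norm w * norm (v :: complex ^ 'n)"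
  by (simp add: norm_vec_def norm_mult L2_set_right_distrib)

lemma holomorphic_map_on_imp_continuous_on:
  "holomorphic_map_on \<phi> D \<Longrightarrow> continuous_on D \<phi>"
  using continuous_on_vec_lambda[of D "\<lambda>i z. \<phi> z $ i"]
  by (simp add: holomorphic_map_on_def holomorphic_on_imp_continuous_on)

lemma continuous_on_map_deriv:
  "open D \<Longrightarrow> holomorphic_map_on \<phi> D \<Longrightarrow> continuous_on D (map_deriv \<phi>)"
  unfolding map_deriv_def holomorphic_map_on_def
  by (intro continuous_on_vec_lambda holomorphic_on_imp_continuous_on holomorphic_deriv) auto

lemma has_vector_derivative_holomorphic_map_line:
  fixes \<phi> :: "complex \<Rightarrow> complex ^ 'n"
  assumes "open D" "holomorphic_map_on \<phi> D" "c + of_real s * \<omega> \<in> D"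
  shows "((\<lambda>s. \<phi> (c + of_real s * \<omega>)) has_vector_derivative
          (\<chi> i. \<omega> * map_deriv \<phi> (c + of_real s * \<omega>) $ i)) (at s within S)"
proof -
  have comp: "((\<lambda>s. \<phi> (c + of_real s * \<omega>) $ i) has_vector_derivative
      \<omega> * deriv (\<lambda>w. \<phi> w $ i) (c + of_real s * \<omega>)) (at s within S)" for i
  proof -
    have "((\<lambda>w. \<phi> w $ i) has_field_derivative deriv (\<lambda>w. \<phi> w $ i) (c + of_real s * \<omega>))
        (at (c + of_real s * \<omega>))"
      using assms by (intro holomorphic_derivI[of _ D]) (auto simp: holomorphic_map_on_def)
    moreover have "((\<lambda>s. c + of_real s * \<omega>) has_vector_derivative \<omega>) (at s within S)"
      by (auto intro!: derivative_eq_intros)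
    ultimately show ?thesis
      using field_vector_diff_chain_within[of "\<lambda>s. c + of_real s * \<omega>" \<omega> s S "\<lambda>w. \<phi> w $ i"]
      by (simp add: o_def has_field_derivative_at_within)
  qed
  show ?thesis
    unfolding has_vector_derivative_def
  proof (subst has_derivative_componentwise_within, intro ballI)
    fix b :: "complex ^ 'n" assume "b \<in> Basis"
    then obtain i u where b: "b = axis i u" by (auto simp: Basis_vec_def)
    show "((\<lambda>x. \<phi> (c + of_real x * \<omega>) \<bullet> b) has_derivative
        (\<lambda>x. (x *\<^sub>R (\<chi> i. \<omega> * map_deriv \<phi> (c + of_real s * \<omega>) $ i)) \<bullet> b)) (at s within S)"
      using has_derivative_inner_left[OF comp[of i, unfolded has_vector_derivative_def], of u]
      by (simp add: b inner_axis map_deriv_def)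
  qed
qed

text \<open>
  The length-area inequality on one segment, parametrised by arc length.
\<close>

lemma nn_integral_map_deriv_segment_ge:
  fixes \<phi> :: "complex \<Rightarrow> complex ^ 'n"
  assumes D: "open D" "holomorphic_map_on \<phi> D" and \<omega>: "norm \<omega> = 1"
    and xy: "x \<le> y" "y - x \<le> L" "0 < L"
    and seg: "\<And>s. s \<in> {x..y} \<Longrightarrow> c + of_real s * \<omega> \<in> D"
    and J: "0 \<le> J" "J \<le> norm (\<phi> (c + of_real y * \<omega>) - \<phi> (c + of_real x * \<omega>))"
  shows "ennreal (J\<^sup>2 / L) \<le>
    (\<integral>\<^sup>+s\<in>{x..y}. ennreal ((norm (map_deriv \<phi> (c + of_real s * \<omega>)))\<^sup>2) \<partial>lborel)"
proof -
  define g where "g s = norm (map_deriv \<phi> (c + of_real s * \<omega>))" for s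
  have g_cont: "continuous_on {x..y} g"
    unfolding g_def using seg
    by (intro continuous_on_norm continuous_on_compose2[OF continuous_on_map_deriv[OF D]]
        continuous_intros) auto
  have int: "g integrable_on {x..y}" "(\<lambda>s. (g s)\<^sup>2) integrable_on {x..y}"
    using g_cont by (auto intro!: integrable_continuous_real continuous_intros)
  let ?v = "\<lambda>s. \<chi> i. \<omega> * map_deriv \<phi> (c + of_real s * \<omega>) $ i"
  have v: "(?v has_integral \<phi> (c + of_real y * \<omega>) - \<phi> (c + of_real x * \<omega>)) {x..y}"
    using has_vector_derivative_holomorphic_map_line[OF D] seg xy
    by (intro fundamental_theorem_of_calculus) auto
  have "norm (integral {x..y} ?v) \<le> integral {x..y} g"
    using v int(1) by (intro integral_norm_bound_integral) (auto simp: norm_vec_lambda_mult \<omega> g_def)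
  then have "J \<le> integral {x..y} g"
    using J(2) integral_unique[OF v] by simp
  \<comment> \<open>Cauchy--Schwarz, as the integral of \<open>(g - J / L)\<^sup>2 \<ge> 0\<close>.\<close>
  then have "J\<^sup>2 / L \<le> 2 * (J / L) * integral {x..y} g - (J / L)\<^sup>2 * (y - x)"
    using xy J(1) mult_left_mono[of J "integral {x..y} g" "2 * (J / L)"]
      mult_left_mono[of "y - x" L "(J / L)\<^sup>2"]
    by (simp add: power2_eq_square)
  also have "\<dots> = integral {x..y} (\<lambda>s. 2 * (J / L) * g s - (J / L)\<^sup>2)"
    using int xy by (subst integral_diff) (auto intro: integrable_on_mult_right)
  also have "\<dots> \<le> integral {x..y} (\<lambda>s. (g s)\<^sup>2)"
  proof (rule integral_le)
    show "2 * (J / L) * g s - (J / L)\<^sup>2 \<le> (g s)\<^sup>2" for s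
      using zero_le_power2[of "g s - J / L"] by (simp add: power2_eq_square algebra_simps)
    show "(\<lambda>s. 2 * (J / L) * g s - (J / L)\<^sup>2) integrable_on {x..y}"
      using int(1) by (intro integrable_diff integrable_on_mult_right integrable_const_ivl)
  qed (rule int(2))
  finally show ?thesis
    using nn_integral_has_integral_lebesgue'[OF _ integrable_integral[OF int(2)]]
    by (simp add: g_def ennreal_leI)
qed

lemma first_crossing:
  fixes k :: "real \<Rightarrow> real"
  assumes k: "continuous_on {x..y} k" and "x \<le> y" and m: "k x \<le> m" "m \<le> k y"
  obtains y' where "x \<le> y'" "y' \<le> y" "k y' = m" "\<And>s. s \<in> {x..y'} \<Longrightarrow> k s \<le> m"
proof -
  define S where "S = {s \<in> {x..y}. m \<le> k s}"
  have "S = {x..y} \<inter> k -` {m..}" by (auto simp: S_def)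
  then have "closed S" using k by (simp add: continuous_closed_preimage)
  moreover have "S \<noteq> {}" "bdd_below S" using \<open>x \<le> y\<close> m by (auto simp: S_def intro!: bdd_belowI)
  ultimately have Inf: "Inf S \<in> S" by (simp add: closed_contains_Inf)
  have least: "Inf S \<le> s" if "s \<in> S" for s using that \<open>bdd_below S\<close> by (rule cInf_lower)
  have "\<exists>s\<ge>x. s \<le> Inf S \<and> k s = m"
    using Inf m by (intro IVT' continuous_on_subset[OF k]) (auto simp: S_def)
  then obtain s where s: "x \<le> s" "s \<le> Inf S" "k s = m" by auto
  then have eq: "s = Inf S" using least[of s] Inf by (auto simp: S_def)
  show thesis
  proof (rule that)
    show "k s' \<le> m" if "s' \<in> {x..Inf S}" for s'
    proof (cases "s' = Inf S")
      case False
      then have "s' \<notin> S" using that least[of s'] by auto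
      then show ?thesis using that Inf by (auto simp: S_def)
    qed (use s eq in simp)
  qed (use s eq Inf in \<open>auto simp: S_def\<close>)
qed

text \<open>
  Here \<open>h\<close> is \<open>\<bar>\<phi>\<bar>\<close> extended by \<open>R\<close> to the complement of \<open>D\<close>. The points at parameters \<open>x\<close> and \<open>y\<close>
  need not be joined by a segment in \<open>D\<close>, and \<open>y < x\<close> is allowed; but going from \<open>x\<close> towards \<open>y\<close> up
  to the first point where \<open>h\<close> has increased by \<open>J\<close> stays in \<open>{h < R}\<close>, hence in \<open>D\<close>.
\<close>

lemma nn_integral_map_deriv_line_ge:
  fixes \<phi> :: "complex \<Rightarrow> complex ^ 'n" and h :: "complex \<Rightarrow> real"
  assumes D: "open D" "holomorphic_map_on \<phi> D" and \<omega>: "norm \<omega> = 1"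
    and h: "continuous_on UNIV h" "\<And>z. z \<in> D \<Longrightarrow> h z = norm (\<phi> z)" "\<And>z. z \<notin> D \<Longrightarrow> h z = R"
    and xy: "\<bar>y - x\<bar> \<le> L" "0 < L" and J: "0 \<le> J"
    and hxy: "h (c + of_real x * \<omega>) + J \<le> h (c + of_real y * \<omega>)" "h (c + of_real x * \<omega>) + J < R"
  shows "ennreal (J\<^sup>2 / L) \<le>
    (\<integral>\<^sup>+s. ennreal ((norm (map_deriv \<phi> (c + of_real s * \<omega>)))\<^sup>2) * indicator D (c + of_real s * \<omega>) \<partial>lborel)"
proof -
  define k where "k s = h (c + of_real s * \<omega>)" for s
  have k_cont: "continuous_on X k" for X
    unfolding k_def by (intro continuous_on_compose2[OF h(1)] continuous_intros) auto
  obtain a b where ab: "a \<le> b" "b - a \<le> L" "\<bar>k b - k a\<bar> = J" "\<And>s. s \<in> {a..b} \<Longrightarrow> k s < R"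
  proof (cases "x \<le> y")
    case True
    obtain y' where "x \<le> y'" "y' \<le> y" "k y' = k x + J" "\<And>s. s \<in> {x..y'} \<Longrightarrow> k s \<le> k x + J"
      using first_crossing[OF k_cont[of "{x..y}"] True, of "k x + J"] hxy J unfolding k_def by auto
    then show thesis using xy hxy J that[of x y'] by (force simp: k_def)
  next
    case False
    have "continuous_on {-x..-y} (\<lambda>s. k (- s))"
      by (intro continuous_on_compose2[OF k_cont[of UNIV]] continuous_intros) auto
    from first_crossing[OF this, of "k x + J"]
    obtain y' where y': "-x \<le> y'" "y' \<le> -y" "k (- y') = k x + J"
      and le: "\<And>s. s \<in> {-x..y'} \<Longrightarrow> k (- s) \<le> k x + J"
      using False hxy J unfolding k_def by auto
    have "k s < R" if "s \<in> {-y'..x}" for s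
      using le[of "- s"] that hxy by (auto simp: k_def)
    then show thesis using xy hxy J y' that[of "-y'" x] by force
  qed
  have inD: "c + of_real s * \<omega> \<in> D" if "s \<in> {a..b}" for s
    using ab(4)[OF that] h(3) unfolding k_def by force
  have "\<bar>norm (\<phi> (c + of_real b * \<omega>)) - norm (\<phi> (c + of_real a * \<omega>))\<bar> = J"
    using ab h(2) inD unfolding k_def by auto
  then have "J \<le> norm (\<phi> (c + of_real b * \<omega>) - \<phi> (c + of_real a * \<omega>))"
    using norm_triangle_ineq3 by metis
  from nn_integral_map_deriv_segment_ge[OF D \<omega> ab(1,2) xy(2) inD J this]
  show ?thesis
    by (rule order_trans) (auto intro!: nn_integral_mono simp: inD split: split_indicator)
qed

section \<open>Squares around a boundary point\<close>

text \<open>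
  Two points of the boundary of a square are joined by a chain of at most four pieces of its sides:
  one from each point to a corner, and at most two sides between these corners.
\<close>

lemma square_side_oscillation:
  fixes h :: "complex \<Rightarrow> real" and p :: complex
  defines "S t \<equiv> path_image (rectpath (p - Complex t t) (p + Complex t t))"
  assumes t: "0 < t" and z: "z \<in> S t" and w: "w \<in> S t" and osc: "h z + 4 * M \<le> h w"
  shows "\<exists>\<sigma>\<in>{1, -1}.
    (\<exists>x y. \<bar>y - x\<bar> \<le> 2 * t \<and> h (Complex (Re p + \<sigma> * t) x) + M \<le> h (Complex (Re p + \<sigma> * t) y)) \<or>
    (\<exists>x y. \<bar>y - x\<bar> \<le> 2 * t \<and> h (Complex x (Im p + \<sigma> * t)) + M \<le> h (Complex y (Im p + \<sigma> * t)))"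
proof (rule ccontr)
  assume "\<not> ?thesis"
  then have V: "h (Complex (Re p + \<sigma> * t) y) < h (Complex (Re p + \<sigma> * t) x) + M"
    and H: "h (Complex y (Im p + \<sigma> * t)) < h (Complex x (Im p + \<sigma> * t)) + M"
    if "\<bar>y - x\<bar> \<le> 2 * t" "\<sigma> \<in> {1, -1}" for \<sigma> x y
    using that by (meson not_le)+
  \<comment> \<open>The values of \<open>h\<close> at the four corners.\<close>
  define C where "C \<sigma> \<tau> = h (Complex (Re p + \<sigma> * t) (Im p + \<tau> * t))" for \<sigma> \<tau>
  have adj: "\<bar>C \<sigma> 1 - C \<sigma> (-1)\<bar> < M" "\<bar>C 1 \<sigma> - C (-1) \<sigma>\<bar> < M" if "\<sigma> \<in> {1, -1}" for \<sigma>
    using V[of "Im p + t" "Im p - t" \<sigma>] V[of "Im p - t" "Im p + t" \<sigma>]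
      H[of "Re p + t" "Re p - t" \<sigma>] H[of "Re p - t" "Re p + t" \<sigma>] that t
    by (auto simp: C_def abs_less_iff algebra_simps)
  have corner: "\<exists>\<sigma>\<in>{1, -1}. \<exists>\<tau>\<in>{1, -1}. \<bar>h u - C \<sigma> \<tau>\<bar> < M" if "u \<in> S t" for u
  proof -
    from that t have "(\<exists>\<sigma>\<in>{1, -1}. Re u = Re p + \<sigma> * t \<and> \<bar>Im u - Im p\<bar> \<le> t) \<or>
        (\<exists>\<sigma>\<in>{1, -1}. Im u = Im p + \<sigma> * t \<and> \<bar>Re u - Re p\<bar> \<le> t)"
      unfolding S_def by (subst (asm) path_image_rectpath) auto
    then show ?thesis
    proof (elim disjE bexE conjE)
      fix \<sigma> assume \<sigma>: "\<sigma> \<in> {1, -1}" "Re u = Re p + \<sigma> * t" "\<bar>Im u - Im p\<bar> \<le> t"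
      then have u: "u = Complex (Re p + \<sigma> * t) (Im u)" by (simp add: complex_eq_iff)
      have "\<bar>h u - C \<sigma> 1\<bar> < M"
        using V[of "Im u" "Im p + t" \<sigma>] V[of "Im p + t" "Im u" \<sigma>] \<sigma> t
        by (subst u) (auto simp: C_def abs_less_iff abs_le_iff)
      then show ?thesis using \<sigma> by blast
    next
      fix \<sigma> assume \<sigma>: "\<sigma> \<in> {1, -1}" "Im u = Im p + \<sigma> * t" "\<bar>Re u - Re p\<bar> \<le> t"
      then have u: "u = Complex (Re u) (Im p + \<sigma> * t)" by (simp add: complex_eq_iff)
      have "\<bar>h u - C 1 \<sigma>\<bar> < M"
        using H[of "Re u" "Re p + t" \<sigma>] H[of "Re p + t" "Re u" \<sigma>] \<sigma> t
        by (subst u) (auto simp: C_def abs_less_iff abs_le_iff)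
      then show ?thesis using \<sigma> by blast
    qed
  qed
  have two_sides: "C \<sigma>' \<tau>' - C \<sigma> \<tau> < 2 * M"
    if "\<sigma> \<in> {1, -1}" "\<tau> \<in> {1, -1}" "\<sigma>' \<in> {1, -1}" "\<tau>' \<in> {1, -1}" for \<sigma> \<tau> \<sigma>' \<tau>'
  proof -
    have "0 < M" using adj(1)[of 1] by simp
    then have "C \<sigma>' \<tau>' - C \<sigma> \<tau>' < M" "C \<sigma> \<tau>' - C \<sigma> \<tau> < M"
      using adj[of \<sigma>] adj[of \<tau>'] that by (elim insertE emptyE; simp add: abs_less_iff)+
    then show ?thesis by simp
  qed
  obtain \<sigma> \<tau> where z': "\<sigma> \<in> {1, -1}" "\<tau> \<in> {1, -1}" "\<bar>h z - C \<sigma> \<tau>\<bar> < M"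
    using corner[OF z] by blast
  obtain \<sigma>' \<tau>' where w': "\<sigma>' \<in> {1, -1}" "\<tau>' \<in> {1, -1}" "\<bar>h w - C \<sigma>' \<tau>'\<bar> < M"
    using corner[OF w] by blast
  show False
    using two_sides[OF z'(1,2) w'(1,2)] z'(3) w'(3) osc by linarith
qed

text \<open>
  Properness in the form in which it is used: \<open>\<bar>\<phi>\<bar>\<close> tends to \<open>R\<close> at the boundary of \<open>D\<close>.
\<close>

lemma continuous_norm_extension:
  fixes \<phi> :: "complex \<Rightarrow> complex ^ 'n"
  assumes D: "open D" and \<phi>: "proper_holomorphic_map D (ball 0 R) \<phi>"
  shows "continuous_on UNIV (\<lambda>z. if z \<in> D then norm (\<phi> z) else R)" (is "continuous_on UNIV ?h")
proof -
  have hol: "holomorphic_map_on \<phi> D" and sub: "\<phi> ` D \<subseteq> ball 0 R"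
    and cpt: "\<And>K. \<lbrakk>compact K; K \<subseteq> ball 0 R\<rbrakk> \<Longrightarrow> compact {z \<in> D. \<phi> z \<in> K}"
    using \<phi> by (auto simp: proper_holomorphic_map_iff_compact)
  have "isCont ?h z" for z
  proof (cases "z \<in> D")
    case True
    have "isCont (\<lambda>z. norm (\<phi> z)) z"
      using holomorphic_map_on_imp_continuous_on[OF hol] D True
      by (simp add: continuous_on_eq_continuous_at)
    moreover have "\<forall>\<^sub>F w in nhds z. ?h w = norm (\<phi> w)"
      using eventually_nhds_in_open[OF D True] by eventually_elim simp
    ultimately show ?thesis by (subst isCont_cong)
  next
    case False
    have "\<forall>\<^sub>F w in nhds z. dist (?h w) R < e" if e: "e > 0" for e
    proof -
      have "closed {w \<in> D. \<phi> w \<in> cball 0 (R - e)}"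
        using e by (intro compact_imp_closed cpt compact_cball) (simp add: cball_subset_ball_iff)
      then have "\<forall>\<^sub>F w in nhds z. w \<in> - {w \<in> D. \<phi> w \<in> cball 0 (R - e)}"
        using False by (intro eventually_nhds_in_open) auto
      then show ?thesis
      proof eventually_elim
        case (elim w)
        then show ?case
          using sub e by (auto simp: dist_real_def image_subset_iff)
      qed
    qed
    then have "(?h \<longlongrightarrow> R) (nhds z)" by (rule tendstoI)
    then have "(?h \<longlongrightarrow> R) (at z)" by (rule tendsto_mono[rotated]) (simp add: at_within_def)
    then show ?thesis using False by (simp add: isCont_def)
  qed
  then show ?thesis by (simp add: continuous_on_eq_continuous_at)
qed

lemma rectpath_not_subset_simply_connected:
  assumes "simply_connected D" "p \<notin> D" "0 < t"
  shows "\<not> path_image (rectpath (p - Complex t t) (p + Complex t t)) \<subseteq> D"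
proof
  assume "path_image (rectpath (p - Complex t t) (p + Complex t t)) \<subseteq> D"
  then have "winding_number (rectpath (p - Complex t t) (p + Complex t t)) p = 0"
    using assms by (intro simply_connected_imp_winding_number_zero[of D])
      (auto intro: valid_path_imp_path)
  moreover have "p \<in> box (p - Complex t t) (p + Complex t t)"
    using \<open>0 < t\<close> by (simp add: in_box_complex_iff)
  ultimately show False using winding_number_rectpath by force
qed

text \<open>
  The constant comes from an increase of \<open>R / 16\<close> along a side of length \<open>2 t\<close>. The oscillation
  obtained on the side is \<open>R / 8\<close>; half of it is used, so that the values stay strictly below \<open>R\<close>.
\<close>

lemma image_area_ge_log:
  fixes \<phi> :: "complex \<Rightarrow> complex ^ 'n"
  assumes R: "0 < R" and D: "open D" "simply_connected D"
    and \<phi>: "proper_holomorphic_map D (ball 0 R) \<phi>"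
    and p: "p \<notin> D" "p \<noteq> 0" and \<delta>: "0 < \<delta>" "\<delta> \<le> 1 / 2"
    and small: "\<And>z. norm z \<le> (1 - \<delta>) * norm p \<Longrightarrow> z \<in> D \<and> norm (\<phi> z) \<le> R / 2"
  shows "ennreal ((R / 16)\<^sup>2 / 2 * ln (1 / (2 * \<delta>))) \<le> 4 * image_area \<phi> D"
proof -
  define d where "d = norm p"
  have d: "0 < d" using p by (simp add: d_def)
  have hol: "holomorphic_map_on \<phi> D" using \<phi> by (simp add: proper_holomorphic_map_def)
  define h where "h z = (if z \<in> D then norm (\<phi> z) else R)" for z
  have h: "continuous_on UNIV h" "\<And>z. z \<in> D \<Longrightarrow> h z = norm (\<phi> z)" "\<And>z. z \<notin> D \<Longrightarrow> h z = R"
    using continuous_norm_extension[OF D(1) \<phi>] by (auto simp: h_def[abs_def])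
  have h_le: "h z \<le> R" for z
    using \<phi> by (auto simp: h_def proper_holomorphic_map_iff_compact image_subset_iff less_imp_le)
  define q where "q z = ennreal ((norm (map_deriv \<phi> z))\<^sup>2) * indicator D z" for z
  have q_meas: "q \<in> borel_measurable borel"
  proof -
    have "(\<lambda>z. indicator D z *\<^sub>R (norm (map_deriv \<phi> z))\<^sup>2) \<in> borel_measurable borel"
      using continuous_on_map_deriv[OF D(1) hol] D(1)
      by (intro borel_measurable_continuous_on_indicator continuous_intros) auto
    moreover have "q z = ennreal (indicator D z *\<^sub>R (norm (map_deriv \<phi> z))\<^sup>2)" for z
      by (simp add: q_def split: split_indicator)
    ultimately show ?thesis by (simp add: q_def[abs_def] cong: measurable_cong)
  qed
  have "ennreal ((R / 16)\<^sup>2 / 2 * ln ((d / 2) / (\<delta> * d))) \<le> 4 * (\<integral>\<^sup>+z. q z \<partial>lborel)"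
  proof (rule four_sides_integral_le[OF q_meas, where p = p])
    fix t assume t: "\<delta> * d \<le> t" "t \<le> d / 2"
    have t0: "0 < t" using t \<delta> d by (meson mult_pos_pos less_le_trans)
    let ?S = "path_image (rectpath (p - Complex t t) (p + Complex t t))"
    obtain w where w: "w \<in> ?S" "h w = R"
      using rectpath_not_subset_simply_connected[OF D(2) p(1) t0] h(3) by blast
    \<comment> \<open>The segment from \<open>0\<close> to \<open>p\<close> crosses the square at the point \<open>(1 - t / m) p\<close>.\<close>
    define m where "m = max \<bar>Re p\<bar> \<bar>Im p\<bar>"
    have m: "d / 2 \<le> m" "m \<le> d"
      using cmod_le[of p] abs_Re_le_cmod[of p] abs_Im_le_cmod[of p] by (auto simp: m_def d_def)
    have m0: "0 < m" using m d by linarith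
    define z where "z = p - of_real (t / m) * p"
    have tm: "0 \<le> t / m" "t / m \<le> 1" using t0 m0 m t by (auto simp: divide_simps)
    have "z = of_real (1 - t / m) * p" by (simp add: z_def algebra_simps)
    then have "norm z = \<bar>1 - t / m\<bar> * d" by (simp only: norm_mult norm_of_real d_def)
    also have "\<dots> = d - t / m * d" using tm by (simp add: algebra_simps)
    also have "\<dots> \<le> (1 - \<delta>) * d"
    proof -
      have "t \<le> t / m * d" using m0 m t0 by (simp add: field_simps)
      then show ?thesis using t by (simp add: algebra_simps)
    qed
    finally have hz: "h z \<le> R / 2" using small[of z] by (simp add: h_def d_def)
    have "\<bar>Re p\<bar> \<le> m" "\<bar>Im p\<bar> \<le> m" "\<bar>Re p\<bar> = m \<or> \<bar>Im p\<bar> = m" by (auto simp: m_def)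
    then have "\<bar>t / m * Re p\<bar> \<le> t" "\<bar>t / m * Im p\<bar> \<le> t"
        "\<bar>t / m * Re p\<bar> = t \<or> \<bar>t / m * Im p\<bar> = t"
      using t0 m0 by (auto simp: abs_mult field_simps)
    then have "z \<in> ?S"
      using t0 by (subst path_image_rectpath) (auto simp: z_def abs_le_iff abs_if split: if_splits)
    then have "\<exists>\<sigma>\<in>{1, -1}. (\<exists>x y. \<bar>y - x\<bar> \<le> 2 * t \<and>
        h (Complex (Re p + \<sigma> * t) x) + R / 8 \<le> h (Complex (Re p + \<sigma> * t) y)) \<or>
      (\<exists>x y. \<bar>y - x\<bar> \<le> 2 * t \<and>
        h (Complex x (Im p + \<sigma> * t)) + R / 8 \<le> h (Complex y (Im p + \<sigma> * t)))"
      using hz w by (intro square_side_oscillation[OF t0 _ w(1)]) auto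
    then obtain \<sigma> where \<sigma>: "\<sigma> \<in> {1, -1}" and osc: "(\<exists>x y. \<bar>y - x\<bar> \<le> 2 * t \<and>
        h (Complex (Re p + \<sigma> * t) x) + R / 8 \<le> h (Complex (Re p + \<sigma> * t) y)) \<or>
      (\<exists>x y. \<bar>y - x\<bar> \<le> 2 * t \<and>
        h (Complex x (Im p + \<sigma> * t)) + R / 8 \<le> h (Complex y (Im p + \<sigma> * t)))"
      by (rule bexE)
    have line: "ennreal ((R / 16)\<^sup>2 / 2 / t) \<le> (\<integral>\<^sup>+s. q (c + of_real s * \<omega>) \<partial>lborel)"
      if "norm \<omega> = 1" "\<bar>y - x\<bar> \<le> 2 * t"
        "h (c + of_real x * \<omega>) + R / 8 \<le> h (c + of_real y * \<omega>)" for c \<omega> x y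
      using nn_integral_map_deriv_line_ge[OF D(1) hol that(1) h that(2), of "R / 16" c] that(3)
        h_le[of "c + of_real y * \<omega>"] R t0 by (simp add: q_def)
    have eqs: "Complex u s = of_real u + of_real s * \<i>" "Complex s u = \<i> * of_real u + of_real s * 1"
      for u s by (simp_all add: complex_eq_iff)
    show "\<exists>\<sigma>\<in>{1, -1}.
      ennreal ((R / 16)\<^sup>2 / 2 / t) \<le> (\<integral>\<^sup>+s. q (Complex (Re p + \<sigma> * t) s) \<partial>lborel) \<or>
      ennreal ((R / 16)\<^sup>2 / 2 / t) \<le> (\<integral>\<^sup>+s. q (Complex s (Im p + \<sigma> * t)) \<partial>lborel)"
      using osc
    proof (elim disjE exE conjE)
      fix x y assume "\<bar>y - x\<bar> \<le> 2 * t"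
        "h (Complex (Re p + \<sigma> * t) x) + R / 8 \<le> h (Complex (Re p + \<sigma> * t) y)"
      then show ?thesis
        using line[of \<i> y x "of_real (Re p + \<sigma> * t)"] \<sigma> unfolding eqs(1) by auto
    next
      fix x y assume "\<bar>y - x\<bar> \<le> 2 * t"
        "h (Complex x (Im p + \<sigma> * t)) + R / 8 \<le> h (Complex y (Im p + \<sigma> * t))"
      then show ?thesis
        using line[of 1 y x "\<i> * of_real (Im p + \<sigma> * t)"] \<sigma> unfolding eqs(2) by auto
    qed
  qed (use \<delta> d in \<open>auto simp: field_simps\<close>)
  moreover have "(d / 2) / (\<delta> * d) = 1 / (2 * \<delta>)" using d by simp
  ultimately show ?thesis by (simp add: image_area_def q_def)
qed

section \<open>The component of the preimage of a small ball\<close>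

lemma norm_vec_le_card:
  fixes v :: "complex ^ 'n"
  assumes "\<And>i. norm (v $ i) \<le> B"
  shows "norm v \<le> real CARD('n) * B"
proof -
  have "norm v \<le> (\<Sum>i\<in>UNIV. norm (v $ i))"
    by (simp add: norm_vec_def L2_set_le_sum)
  also have "\<dots> \<le> real CARD('n) * B"
    using assms sum_bounded_above[of UNIV "\<lambda>i. norm (v $ i)" B] by simp
  finally show ?thesis .
qed

theorem theorem3p2:
  fixes R c :: real and A :: ennreal
  assumes "R > 0" and "A < \<infinity>" and "c > 1"
  shows "\<exists>\<rho>>0. \<exists>a>0. \<forall>(D :: complex set) (\<phi> :: complex \<Rightarrow> complex ^ 'n).
    open D \<and> connected D \<and> simply_connected D \<and> 0 \<in> D \<and>
    proper_holomorphic_map D (ball 0 R) \<phi> \<and> \<phi> 0 = 0 \<and> image_area \<phi> D \<le> A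
    \<longrightarrow> (\<exists>r>0. let D0 = connected_component_set {z \<in> D. \<phi> z \<in> ball 0 (\<rho> * R)} 0 in
          {z :: complex. norm z < a * r} \<subseteq> D0 \<and>
          D0 \<subseteq> {z :: complex. norm z < r} \<and>
          {z :: complex. norm z < r} \<subseteq> {z :: complex. norm z < c * r} \<and>
          {z :: complex. norm z < c * r} \<subseteq> D)"
proof -
  define N where "N = real CARD('n)"
  have N: "1 \<le> N" by (simp add: N_def Suc_leI)
  define J where "J = (R / 16)\<^sup>2 / 2"
  have J: "0 < J" using \<open>R > 0\<close> by (simp add: J_def)
  \<comment> \<open>\<open>\<delta>\<close> makes the lower bound \<open>J ln (1 / (2 \<delta>))\<close> for four times the area exceed \<open>4 A\<close>.\<close>
  define \<delta> where "\<delta> = exp (- (4 * enn2real A + 1) / J) / 2"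
  have \<delta>: "0 < \<delta>" "\<delta> \<le> 1 / 2"
  proof -
    have "- (4 * enn2real A + 1) / J \<le> 0"
      using J enn2real_nonneg[of A] by (intro divide_nonpos_pos) linarith+
    then show "0 < \<delta>" "\<delta> \<le> 1 / 2" by (simp_all add: \<delta>_def)
  qed
  have ln_\<delta>: "J * ln (1 / (2 * \<delta>)) = 4 * enn2real A + 1"
    using J by (simp add: \<delta>_def ln_div)
  obtain \<rho>\<^sub>0 where \<rho>\<^sub>0: "0 < \<rho>\<^sub>0" and small:
    "\<And>f z. \<lbrakk>f holomorphic_on ball 0 1; \<And>w. norm w < 1 \<Longrightarrow> norm (f w) \<le> 1;
       \<And>t. \<lbrakk>0 \<le> t; t \<le> 1 / c\<rbrakk> \<Longrightarrow> \<exists>w. norm w = t \<and> norm (f w) < \<rho>\<^sub>0; norm z \<le> 1 - \<delta>\<rbrakk>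
     \<Longrightarrow> norm (f z) \<le> 1 / (2 * N)"
    using small_on_circles_imp_small[of "1 / c" \<delta> "1 / (2 * N)"] \<delta> N \<open>c > 1\<close> by auto
  \<comment> \<open>With \<open>\<rho> \<le> 1\<close> the inner disc, of radius \<open>\<rho> d / n\<close>, lies in the disc of radius \<open>d\<close>.\<close>
  define \<rho> where "\<rho> = min \<rho>\<^sub>0 1"
  have \<rho>: "0 < \<rho>" "\<rho> \<le> \<rho>\<^sub>0" "\<rho> \<le> 1" using \<rho>\<^sub>0 by (auto simp: \<rho>_def)
  define a where "a = \<rho> * c / N"
  have a: "0 < a" using \<rho> N \<open>c > 1\<close> by (simp add: a_def)
  show ?thesis
  proof (rule exI[of _ \<rho>], rule conjI[OF \<rho>(1)], rule exI[of _ a], rule conjI[OF a],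
      intro allI impI, elim conjE)
    fix D :: "complex set" and \<phi> :: "complex \<Rightarrow> complex ^ 'n"
    assume D: "open D" "simply_connected D" "0 \<in> D"
      and \<phi>: "proper_holomorphic_map D (ball 0 R) \<phi>" and \<phi>0: "\<phi> 0 = 0"
      and area: "image_area \<phi> D \<le> A"
    have hol: "(\<lambda>z. \<phi> z $ i) holomorphic_on D" for i
      using \<phi> by (simp add: proper_holomorphic_map_def holomorphic_map_on_def)
    have lt_R: "norm (\<phi> z) < R" if "z \<in> D" for z
      using \<phi> that by (auto simp: proper_holomorphic_map_iff_compact image_subset_iff)
    have "D \<noteq> UNIV"
    proof
      assume UNIV: "D = UNIV"
      have "\<phi> z $ i = \<phi> 0 $ i" for z i
      proof -
        have "bounded (range (\<lambda>z. \<phi> z $ i))"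
          using order.trans[OF Finite_Cartesian_Product.norm_nth_le less_imp_le[OF lt_R]] UNIV
          by (intro boundedI[of _ R]) auto
        then show ?thesis
          using Liouville_theorem[of "\<lambda>z. \<phi> z $ i"] hol[of i] UNIV by (metis constant_on_def UNIV_I)
      qed
      then have "{z \<in> D. \<phi> z \<in> {0}} = UNIV" using \<phi>0 UNIV by (auto simp: vec_eq_iff)
      moreover have "compact {z \<in> D. \<phi> z \<in> {0}}"
        using \<phi> \<open>R > 0\<close> unfolding proper_holomorphic_map_iff_compact
        by (elim conjE allE[of _ "{0}"]) simp
      ultimately show False using not_compact_UNIV by simp
    qed
    then obtain p where p: "p \<notin> D" and p_min: "\<And>w. w \<notin> D \<Longrightarrow> norm p \<le> norm w"
      using distance_attains_inf[of "- D" 0] \<open>open D\<close> by (auto simp: closed_def)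
    have p0: "p \<noteq> 0" using p D by auto
    define d where "d = norm p"
    have d: "0 < d" using p0 by (simp add: d_def)
    have ball: "z \<in> D" if "norm z < d" for z using p_min[of z] that by (force simp: d_def)
    \<comment> \<open>The components of \<open>\<phi>\<close>, rescaled to map the unit disc into itself.\<close>
    define f where "f i z = \<phi> (of_real d * z) $ i / of_real R" for i z
    have scaled: "norm (of_real d * z) < d" if "norm z < 1" for z :: complex
      using that d by (simp add: norm_mult)
    have f_hol: "f i holomorphic_on ball 0 1" for i
      unfolding f_def using scaled ball \<open>R > 0\<close>
      by (intro holomorphic_intros holomorphic_on_compose_gen[OF _ hol, unfolded o_def]) auto
    have f_le: "norm (f i z) * R \<le> norm (\<phi> (of_real d * z))" for i z
      using \<open>R > 0\<close> by (simp add: f_def norm_divide Finite_Cartesian_Product.norm_nth_le)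
    have f_lt1: "norm (f i z) < 1" if "norm z < 1" for i z
    proof -
      have "norm (f i z) * R < 1 * R"
        using f_le[of i z] lt_R[OF ball[OF scaled[OF that]]] by simp
      then show ?thesis using \<open>R > 0\<close> by simp
    qed
    have \<phi>_f: "norm (\<phi> (of_real d * z)) \<le> N * (B * R)" if "\<And>i. norm (f i z) \<le> B" for z B
      unfolding N_def
    proof (rule norm_vec_le_card)
      show "norm (\<phi> (of_real d * z) $ i) \<le> B * R" for i
        using that[of i] \<open>R > 0\<close> by (simp add: f_def norm_divide field_simps)
    qed
    have unscale: "z = of_real d * (z / of_real d)" for z :: complex using d by simp
    define E where "E = {z \<in> D. \<phi> z \<in> ball 0 (\<rho> * R)}"
    define D0 where "D0 = connected_component_set E 0"
    define r where "r = d / c"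
    have r: "0 < r" "c * r = d" "a * r = \<rho> * d / N" "r < d"
      using d \<open>c > 1\<close> by (auto simp: r_def a_def field_simps)
    have sub1: "ball 0 (a * r) \<subseteq> D0"
      unfolding D0_def
    proof (rule connected_component_maximal)
      show "ball 0 (a * r) \<subseteq> E"
      proof
        fix z :: complex assume "z \<in> ball 0 (a * r)"
        then have z: "norm z < \<rho> * d / N" by (simp add: r)
        also have "\<dots> \<le> d" using \<rho> N d mult_mono[of \<rho> 1 d "d * N"]
          by (simp add: field_simps)
        finally have zd: "norm z < d" .
        then have "norm (z / of_real d) < 1" using d by (simp add: norm_divide)
        moreover have "f i 0 = 0" for i using \<phi>0 by (simp add: f_def)
        ultimately have "norm (f i (z / of_real d)) \<le> norm (z / of_real d)" for i
          using Schwarz_Lemma'[OF f_hol _ f_lt1, of i] by blast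
        then have "norm (f i (z / of_real d)) \<le> norm z / d" for i
          using d by (simp add: norm_divide)
        from \<phi>_f[OF this] have "norm (\<phi> z) \<le> N * (norm z / d * R)"
          using unscale[of z] by simp
        also have "\<dots> < \<rho> * R" using z N d \<open>R > 0\<close> by (simp add: field_simps)
        finally show "z \<in> E" using ball[OF zd] by (simp add: E_def)
      qed
    qed (use mult_pos_pos[OF a r(1)] in simp_all)
    have sub2: "D0 \<subseteq> ball 0 r"
    proof (rule ccontr)
      assume "\<not> D0 \<subseteq> ball 0 r"
      then obtain u where u: "u \<in> D0" "r \<le> norm u" by (auto simp: subset_iff not_less)
      have D0_E: "D0 \<subseteq> E" unfolding D0_def by (rule connected_component_subset)
      have "0 \<in> D0"
        using D \<phi>0 \<rho> \<open>R > 0\<close> by (simp add: D0_def E_def)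
      moreover have "connected (norm ` D0)"
        unfolding D0_def by (intro connected_continuous_image continuous_intros) auto
      ultimately have circ: "\<exists>z\<in>D0. norm z = t" if "0 \<le> t" "t \<le> r" for t
        using connectedD_interval[of "norm ` D0" "norm (0::complex)" "norm u" t] u that by force
      have "\<exists>w. norm w = t \<and> norm (f i w) < \<rho>\<^sub>0" if t: "0 \<le> t" "t \<le> 1 / c" for t i
      proof -
        have "t * d \<le> r" using mult_right_mono[OF t(2), of d] d by (simp add: r_def)
        then obtain z where z: "z \<in> D0" "norm z = t * d" using circ[of "t * d"] t d by auto
        then have "norm (\<phi> z) < \<rho> * R" using D0_E by (auto simp: E_def)
        then have "norm (f i (z / of_real d)) * R < \<rho> * R"
          using f_le[of i "z / of_real d"] d by simp
        then show ?thesis using z d \<rho> \<open>R > 0\<close>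
          by (intro exI[of _ "z / of_real d"]) (auto simp: norm_divide)
      qed
      then have f_small: "norm (f i z) \<le> 1 / (2 * N)" if "norm z \<le> 1 - \<delta>" for i z
        using small[OF f_hol, of i z] f_lt1 that by (meson less_imp_le)
      have "z \<in> D \<and> norm (\<phi> z) \<le> R / 2" if z: "norm z \<le> (1 - \<delta>) * norm p" for z
      proof
        have "(1 - \<delta>) * d < d" using \<delta> d by simp
        then show "z \<in> D" using ball z by (simp add: d_def)
        have "norm (z / of_real d) \<le> 1 - \<delta>" using z d by (simp add: norm_divide d_def field_simps)
        then have "norm (\<phi> (of_real d * (z / of_real d))) \<le> N * (1 / (2 * N) * R)"
          by (intro \<phi>_f f_small)
        then show "norm (\<phi> z) \<le> R / 2" using N d by simp
      qed
      from image_area_ge_log[OF \<open>R > 0\<close> D(1,2) \<phi> p p0 \<delta> this]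
      have "ennreal (4 * enn2real A + 1) \<le> 4 * image_area \<phi> D"
        unfolding J_def[symmetric] ln_\<delta> .
      also have "\<dots> \<le> 4 * A" using area by (intro mult_left_mono) auto
      also have "\<dots> = ennreal (4 * enn2real A)"
        using \<open>A < \<infinity>\<close> by (simp add: ennreal_mult)
      finally show False by (subst (asm) ennreal_le_iff) auto
    qed
    show "\<exists>r>0. let D0 = connected_component_set {z \<in> D. \<phi> z \<in> ball 0 (\<rho> * R)} 0 in
          {z :: complex. norm z < a * r} \<subseteq> D0 \<and>
          D0 \<subseteq> {z :: complex. norm z < r} \<and>
          {z :: complex. norm z < r} \<subseteq> {z :: complex. norm z < c * r} \<and>
          {z :: complex. norm z < c * r} \<subseteq> D"
      using sub1 sub2 ball r unfolding Let_def D0_def[unfolded E_def, symmetric]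
      by (intro exI[of _ r]) (auto simp: subset_iff)
  qed
qed

end
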